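(* Let $n \ge 1$ be an integer and let $T_1, \dots, T_n$ be the Chebyshev polynomials. For any choice of signs $x_1, \dots, x_n \in \{-1,1\}$ we have \[\Big\|\sum_{i=1}^n x_i T_i \Big\|_\infty \ge \sqrt{n/2}.\]
   Context: For a univariate real polynomial $p : \mathbb{R} \to \mathbb{R}$, the Chebyshev norm is $\|p\|_\infty := \sup_{|x| \le 1} |p(x)|$, the supremum being over real $x \in [-1,1]$. $T_k$ denotes the $k$-th Chebyshev polynomial (of the first kind), i.e. the real polynomial satisfying $T_k(\cos\theta) = \cos(k\theta)$ for all $\theta \in \mathbb{R}$. *)

theory Defs
  imports "HOL-Analysis.Analysis" "HOL-Computational_Algebra.Polynomial"
begin

definition cheb_norm :: "real poly \<Rightarrow> real" where
  "cheb_norm p = (SUP x\<in>{-1..1}. \<bar>poly p x\<bar>)"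

text \<open>The supremum is taken over a bounded set, so it is the genuine one.\<close>

lemma bdd_above_cheb_norm: "bdd_above ((\<lambda>x. \<bar>poly p x\<bar>) ` {-1..1::real})"
  by (intro bounded_imp_bdd_above compact_imp_bounded compact_continuous_image
      continuous_intros) auto

definition cheb_T :: "nat \<Rightarrow> real poly" where
  "cheb_T k = (THE p. \<forall>\<theta>::real. poly p (cos \<theta>) = cos (real k * \<theta>))"

text \<open>The description operator is justified by existence and uniqueness.\<close>

lemma cheb_T_exists: "\<exists>p::real poly. \<forall>\<theta>. poly p (cos \<theta>) = cos (real k * \<theta>)"
proof (induction k rule: less_induct)
  case (less k)
  consider "k = 0" | "k = 1" | m where "k = Suc (Suc m)"
    by (metis One_nat_def not0_implies_Suc)
  then show ?case
  proof cases
    case 1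
    then show ?thesis by (intro exI[of _ 1]) simp
  next
    case 2
    then show ?thesis by (intro exI[of _ "[:0, 1:]"]) simp
  next
    case 3
    obtain p q :: "real poly"
      where p: "\<And>\<theta>. poly p (cos \<theta>) = cos (real m * \<theta>)"
        and q: "\<And>\<theta>. poly q (cos \<theta>) = cos (real (Suc m) * \<theta>)"
      using less.IH[of m] less.IH[of "Suc m"] 3 by auto
    have "poly ([:0, 2:] * q - p) (cos \<theta>) = cos (real k * \<theta>)" for \<theta>
    proof -
      have a: "real k * \<theta> = real (Suc m) * \<theta> + \<theta>" and b: "real m * \<theta> = real (Suc m) * \<theta> - \<theta>"
        using 3 by (simp_all add: algebra_simps)
      show ?thesis
        unfolding a poly_diff poly_mult p q b cos_add cos_diff by simp
    qed
    then show ?thesis by blast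
  qed
qed

lemma cheb_T_unique:
  fixes p q :: "real poly"
  assumes "\<forall>\<theta>. poly p (cos \<theta>) = cos (real k * \<theta>)"
    and "\<forall>\<theta>. poly q (cos \<theta>) = cos (real k * \<theta>)"
  shows "p = q"
proof (rule ccontr)
  assume "p \<noteq> q"
  then have "finite {x. poly (p - q) x = 0}"
    by (intro poly_roots_finite) simp
  moreover have "{-1..1} \<subseteq> {x. poly (p - q) x = 0}"
  proof
    fix x :: real
    assume "x \<in> {-1..1}"
    then have "x = cos (arccos x)" by simp
    then show "x \<in> {x. poly (p - q) x = 0}"
      using assms by (metis (mono_tags, lifting) mem_Collect_eq poly_diff right_minus_eq)
  qed
  ultimately have "finite {-1..1::real}"
    using finite_subset by blast
  then show False
    using infinite_Icc[of "-1" "1::real"] by simp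
qed

lemma poly_cheb_T_cos: "poly (cheb_T k) (cos \<theta>) = cos (real k * \<theta>)"
proof -
  have "\<exists>!p::real poly. \<forall>\<theta>. poly p (cos \<theta>) = cos (real k * \<theta>)"
    using cheb_T_exists[of k] cheb_T_unique by blast
  from theI'[OF this] show ?thesis
    unfolding cheb_T_def by blast
qed

end

theory Submission
  imports Defs
begin

text \<open>
  Substituting \<open>t = cos \<theta>\<close> turns the Chebyshev sum into a cosine polynomial. The functions
  \<open>cos (k \<theta>)\<close> are orthogonal on \<open>[0, \<pi>]\<close> with squared norm \<open>\<pi>/2\<close>, so the mean square of that
  polynomial is \<open>n/2\<close>, and the supremum is at least the root mean square.
\<close>

lemma abs_poly_le_cheb_norm:
  assumes "t \<in> {-1..1}"
  shows "\<bar>poly p t\<bar> \<le> cheb_norm p"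
  unfolding cheb_norm_def by (rule cSUP_upper[OF assms bdd_above_cheb_norm])

text \<open>For nonzero \<open>m\<close> the antiderivative \<open>sin (m * \<theta>) / m\<close>
  vanishes at both endpoints, because \<open>m\<close> is an integer. Taking \<open>m\<close> in
  \<open>int\<close> rather than \<open>nat\<close> lets the lemma apply to a difference of two
  frequencies of either sign.\<close>

lemma has_integral_cos_int_multiple:
  fixes m :: int
  shows "((\<lambda>\<theta>. cos (of_int m * \<theta>)) has_integral (if m = 0 then pi else 0)) {0..pi}"
proof (cases "m = 0")
  case True
  then show ?thesis
    using has_integral_const_real[of "1::real" 0 pi] by simp
next
  case False
  have "((\<lambda>\<theta>. cos (of_int m * \<theta>)) has_integral
      sin (of_int m * pi) / of_int m - sin (of_int m * 0) / of_int m) {0..pi}"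
    by (rule fundamental_theorem_of_calculus)
      (use False in \<open>auto intro!: derivative_eq_intros
        simp flip: has_real_derivative_iff_has_vector_derivative\<close>)
  moreover have "sin (of_int m * pi) = 0"
    by (simp add: sin_zero_iff_int2)
  ultimately show ?thesis
    using False by simp
qed

text \<open>By the product-to-sum formula, only the frequencies \<open>i - j\<close> and
  \<open>i + j\<close> occur. Since \<open>i > 0\<close>, the second is never zero, so only the
  first can contribute, and it does so exactly when \<open>i = j\<close>. For
  \<open>i = j = 0\<close> the integral would be \<open>pi\<close> instead of
  \<open>pi / 2\<close>.\<close>

lemma has_integral_cos_mult_cos:
  fixes i j :: nat
  assumes "i > 0"
  shows "((\<lambda>\<theta>. cos (real i * \<theta>) * cos (real j * \<theta>)) has_integral
    (if i = j then pi / 2 else 0)) {0..pi}"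
proof -
  have "((\<lambda>\<theta>. (cos (of_int (int i - int j) * \<theta>) + cos (of_int (int i + int j) * \<theta>)) / 2)
      has_integral ((if int i - int j = 0 then pi else 0) + (if int i + int j = 0 then pi else 0)) / 2)
      {0..pi}"
    by (intro has_integral_divide has_integral_add has_integral_cos_int_multiple)
  then show ?thesis
    using assms by (simp add: cos_times_cos algebra_simps split: if_splits)
qed

text \<open>This is Parseval's identity: after expanding the square into a double sum, orthogonality
  leaves only the diagonal terms.\<close>

lemma has_integral_cos_sum_square:
  fixes x :: "nat \<Rightarrow> real"
  shows "((\<lambda>\<theta>. (\<Sum>i=1..n. x i * cos (real i * \<theta>))\<^sup>2) has_integral
    pi / 2 * (\<Sum>i=1..n. (x i)\<^sup>2)) {0..pi}"
proof -
  have "((\<lambda>\<theta>. \<Sum>i=1..n. \<Sum>j=1..n. x i * x j * (cos (real i * \<theta>) * cos (real j * \<theta>)))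
      has_integral (\<Sum>i=1..n. \<Sum>j=1..n. x i * x j * (if i = j then pi / 2 else 0))) {0..pi}"
    by (intro has_integral_sum has_integral_mult_right has_integral_cos_mult_cos) auto
  moreover have "(\<Sum>i=1..n. \<Sum>j=1..n. x i * x j * (if i = j then pi / 2 else 0))
      = pi / 2 * (\<Sum>i=1..n. (x i)\<^sup>2)"
    unfolding sum_distrib_left
    by (rule sum.cong) (simp_all add: if_distrib power2_eq_square cong: if_cong)
  moreover have "(\<Sum>i=1..n. x i * cos (real i * \<theta>))\<^sup>2
      = (\<Sum>i=1..n. \<Sum>j=1..n. x i * x j * (cos (real i * \<theta>) * cos (real j * \<theta>)))" for \<theta>
    by (simp add: power2_eq_square sum_product mult_ac)
  ultimately show ?thesis
    by (simp only:)
qed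

theorem theorem2:
  fixes n :: nat and x :: "nat \<Rightarrow> real"
  assumes "n \<ge> 1"
    and "\<And>i. i \<in> {1..n} \<Longrightarrow> x i \<in> {-1, 1}"
  shows "cheb_norm (\<Sum>i=1..n. smult (x i) (cheb_T i)) \<ge> sqrt (real n / 2)"
proof -
  define p where "p = (\<Sum>i=1..n. smult (x i) (cheb_T i))"
  have p_cos: "poly p (cos \<theta>) = (\<Sum>i=1..n. x i * cos (real i * \<theta>))" for \<theta>
    by (simp add: p_def poly_sum poly_cheb_T_cos)
  \<comment> \<open>The signs enter only through their squares, so the mean square is the same for
    every choice.\<close>
  have "(x i)\<^sup>2 = 1" if "i \<in> {1..n}" for i
    using assms(2)[OF that] by auto
  then have "(\<Sum>i=1..n. (x i)\<^sup>2) = real n"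
    by simp
  then have "((\<lambda>\<theta>. (poly p (cos \<theta>))\<^sup>2) has_integral pi / 2 * real n) {0..pi}"
    using has_integral_cos_sum_square[of x n] by (simp add: p_cos)
  moreover have "((\<lambda>\<theta>. (cheb_norm p)\<^sup>2) has_integral pi * (cheb_norm p)\<^sup>2) {0..pi}"
    using has_integral_const_real[of "(cheb_norm p)\<^sup>2" 0 pi] by simp
  moreover have bound: "\<bar>poly p (cos \<theta>)\<bar> \<le> cheb_norm p" for \<theta>
    by (rule abs_poly_le_cheb_norm) simp
  then have "(poly p (cos \<theta>))\<^sup>2 \<le> (cheb_norm p)\<^sup>2" for \<theta>
    using power_mono[OF bound, of \<theta> 2] by simp
  ultimately have "pi / 2 * real n \<le> pi * (cheb_norm p)\<^sup>2"
    by (rule has_integral_le)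
  then have "real n / 2 \<le> (cheb_norm p)\<^sup>2"
    by simp
  \<comment> \<open>Nonnegativity is what allows passing from the bound on the square to the square
    root; it follows since the norm dominates an absolute value.\<close>
  moreover have "0 \<le> cheb_norm p"
    using bound[of 0] by linarith
  ultimately show ?thesis
    unfolding p_def by (rule real_le_lsqrt[rotated])
qed

end
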